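(* Let $(A,+,\vee,\wedge,\ast,0)$ be an AL-monoid with unity $1$. If for each $a\in A$ the mapping $x\mapsto a\ast x$ is an isometry of $A$, then $A$ is a Boolean algebra (that is, the lattice $(A,\vee,\wedge)$ with least element $0$ and greatest element $1$ is a Boolean algebra).
   Context: A commutative lattice ordered monoid $(A,+,\vee,\wedge,0)$ is a commutative monoid $(A,+)$ with identity element $0$ together with a lattice structure $(A,\vee,\wedge)$ such that $a+(b\vee c)=(a+b)\vee(a+c)$ and $a+(b\wedge c)=(a+b)\wedge(a+c)$ for all $a,b,c\in A$; $\leq$ denotes the lattice order. The element $0$ is not assumed to be the least element of $A$. An autometrized lattice ordered monoid (AL-monoid) is an algebra $(A,+,\vee,\wedge,\ast,0)$ of arity $(2,2,2,2,0)$ such that: (1) $(A,+,\vee,\wedge,0)$ is a commutative lattice ordered monoid; (2) $a\ast(a\wedge b)+b=a\vee b$ for all $a,b\in A$ (here $a\ast(a\wedge b)+b$ means $(a\ast(a\wedge b))+b$); (3) for each $a\in A$, the mappings $x\mapsto a+x$, $x\mapsto a\vee x$, $x\mapsto a\wedge x$ and $x\mapsto a\ast x$ are contractions with respect to $\ast$, where $f:A\to A$ is a contraction if $f(x)\ast f(y)\leq x\ast y$ for all $x,y\in A$; (4) $[a\ast(a\vee b)]\wedge[b\ast(a\vee b)]=0$ for all $a,b\in A$. $A$ has unity $1$ if $1\in A$ is an element such that $a+(a\ast 1)=1$ for all $a\in A$. An isometry of $A$ is a bijective mapping $\sigma:A\to A$ such that $\sigma(x)\ast\sigma(y)=x\ast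 y$ for all $x,y\in A$. *)

theory Defs
  imports Main
begin

class comm_lattice_ordered_monoid = comm_monoid_add + lattice +
  assumes add_sup_distrib: "a + sup b c = sup (a + b) (a + c)"
    and add_inf_distrib: "a + inf b c = inf (a + b) (a + c)"

definition (in ord) contraction :: "('a \<Rightarrow> 'a \<Rightarrow> 'a) \<Rightarrow> ('a \<Rightarrow> 'a) \<Rightarrow> bool"
  where "contraction d f \<longleftrightarrow> (\<forall>x y. d (f x) (f y) \<le> d x y)"

class al_monoid = comm_lattice_ordered_monoid +
  fixes star :: "'a \<Rightarrow> 'a \<Rightarrow> 'a"  (infixl \<open>\<star>\<close> 70)
  assumes star_inf_add: "(a \<star> inf a b) + b = sup a b"
    and contraction_add: "contraction (\<star>) (\<lambda>x. a + x)"
    and contraction_sup: "contraction (\<star>) (\<lambda>x. sup a x)"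
    and contraction_inf: "contraction (\<star>) (\<lambda>x. inf a x)"
    and contraction_star: "contraction (\<star>) (\<lambda>x. a \<star> x)"
    and star_sup_disjoint: "inf (a \<star> sup a b) (b \<star> sup a b) = 0"
begin

definition unity :: "'a \<Rightarrow> bool"
  where "unity u \<longleftrightarrow> (\<forall>a. a + (a \<star> u) = u)"

definition isometry :: "('a \<Rightarrow> 'a) \<Rightarrow> bool"
  where "isometry f \<longleftrightarrow> bij f \<and> (\<forall>x y. f x \<star> f y = x \<star> y)"

end

text \<open>
  The library class \<open>boolean_algebra\<close> is used as a predicate on the given lattice.
  Its difference operation is not extra structure: it is determined by the complement,
  so only the complement is asserted to exist.
\<close>

definition boolean_lattice :: "'a::lattice \<Rightarrow> 'a \<Rightarrow> bool"
  where "boolean_lattice b t \<longleftrightarrow>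
    (\<exists>compl. class.boolean_algebra (\<lambda>x y. inf x (compl y)) compl inf (\<le>) (<) sup b t)"

end

(* Under the isometry hypothesis every element is a value of the metric, so 0 is the least
   element, and each x \<mapsto> a \<star> x is an involution; with the symmetry of \<star> this makes (A, \<star>, 0) a
   group of exponent 2. For b \<le> a the element a \<star> b is the least z with a \<le> z + b, so
   b \<le> a implies a \<star> b \<le> a. Applied to a = x and the residual (x + x) \<star> x this forces
   x + x = x, hence + is the join, and its distributivity over \<and> is that of the lattice.
   The complement of x is x \<star> 1, their join is x + (x \<star> 1) = 1, and axiom (4) for this
   pair gives x \<and> (x \<star> 1) = 0. *)

theory Submission
  imports Defs
begin

context al_monoid
begin

lemma star_self [simp]: "a \<star> a = 0"
  using star_sup_disjoint[of a a] by simp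

lemma star_add_le: "(a + x) \<star> (a + y) \<le> x \<star> y"
  using contraction_add[of a] by (simp add: contraction_def)

lemma star_sup_le: "sup a x \<star> sup a y \<le> x \<star> y"
  using contraction_sup[of a] by (simp add: contraction_def)

lemma star_inf_le: "inf a x \<star> inf a y \<le> x \<star> y"
  using contraction_inf[of a] by (simp add: contraction_def)

lemma star_star_le: "(a \<star> x) \<star> (a \<star> y) \<le> x \<star> y"
  using contraction_star[of a] by (simp add: contraction_def)

lemma star_add_cancel: "b \<le> a \<Longrightarrow> a \<star> b + b = a"
  using star_inf_add[of a b] by (simp add: inf_absorb2 sup_absorb1)

lemma star_zero_right: "0 \<le> a \<Longrightarrow> a \<star> 0 = a"
  using star_add_cancel[of 0 a] by simp

text \<open>Axiom (4) yields this only when the left argument lies below the right one. For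
  arbitrary \<open>a\<close>, \<open>b\<close>, joining with \<open>b\<close> contracts the pair to
  \<open>sup a b\<close>, \<open>b\<close>, and contraction under \<open>b \<star>\<close> swaps
  these two.\<close>

lemma star_nonneg: "0 \<le> a \<star> b"
proof -
  have le: "0 \<le> x \<star> y" if "x \<le> y" for x y
    using star_sup_disjoint[of x y] that by (simp add: sup_absorb2 inf.absorb_iff2)
  have "b \<star> sup a b \<le> sup a b \<star> b"
    using star_star_le[of b "sup a b" b] le[of b "sup a b"] by (simp add: star_zero_right)
  also have "sup a b \<star> b \<le> a \<star> b"
    using star_sup_le[of b a b] by (simp add: sup_commute)
  finally show ?thesis
    using le[of b "sup a b"] by (meson order_trans sup_ge2)
qed

lemma star_commute: "a \<star> b = b \<star> a"
proof -
  have "x \<star> y \<le> y \<star> x" for x y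
    \<comment> \<open>As \<open>x \<star> x = 0\<close>, the left side of this instance is
      \<open>x \<star> y\<close> itself.\<close>
    using star_star_le[of x y x] by (simp add: star_zero_right star_nonneg)
  then show ?thesis
    by (simp add: order.antisym)
qed

lemma add_mono_right: "b \<le> c \<Longrightarrow> a + b \<le> a + c"
  using add_sup_distrib[of a b c] by (simp add: sup_absorb2 le_iff_sup)

text \<open>Meeting with \<open>b\<close> sends \<open>z + a\<close> to \<open>b\<close> and fixes
  \<open>a\<close>; adding \<open>a\<close> sends \<open>z\<close> and \<open>0\<close> to
  \<open>z + a\<close> and \<open>a\<close>. Both maps are contractions.\<close>

lemma star_le_residual:
  assumes "0 \<le> z" "a \<le> b" "b \<le> z + a"
  shows "b \<star> a \<le> z"
proof -
  have "b \<star> a \<le> (z + a) \<star> a"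
    using star_inf_le[of b "z + a" a] assms by (simp add: inf_absorb1 inf_absorb2)
  also have "\<dots> \<le> z \<star> 0"
    using star_add_le[of a z 0] by (simp add: add.commute)
  finally show ?thesis
    using assms by (simp add: star_zero_right)
qed

context
  assumes isometry_star: "\<And>a. isometry (\<lambda>x. a \<star> x)"
begin

lemma zero_least: "0 \<le> a"
proof -
  obtain x where "a = 0 \<star> x"
    using isometry_star[of 0] unfolding isometry_def by (metis bij_pointE)
  then show ?thesis
    by (simp add: star_nonneg)
qed

lemma star_star_star: "(a \<star> x) \<star> (a \<star> y) = x \<star> y"
  using isometry_star[of a] by (simp add: isometry_def)

lemma star_zero [simp]: "a \<star> 0 = a"
  by (simp add: star_zero_right zero_least)

lemma star_involution: "a \<star> (a \<star> x) = x"
  using star_star_star[of a 0 x] by (simp add: star_commute[of 0])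

lemma star_assoc: "(a \<star> b) \<star> c = a \<star> (b \<star> c)"
proof -
  \<comment> \<open>Expanding \<open>c\<close> by the involution creates a common left factor
    \<open>b\<close>, which the isometry cancels.\<close>
  have "(a \<star> b) \<star> c = (b \<star> a) \<star> (b \<star> (b \<star> c))"
    by (simp add: star_commute[of a b] star_involution)
  then show ?thesis
    by (simp add: star_star_star)
qed

lemma le_add_right: "a \<le> a + b"
  using add_mono_right[OF zero_least, of a b] by simp

lemma star_le_left: "b \<le> a \<Longrightarrow> a \<star> b \<le> a"
  by (simp add: star_le_residual zero_least le_add_right)

lemma add_idem: "a + a = a"
proof (rule order.antisym)
  \<comment> \<open>The involution recovers \<open>a + a\<close> as \<open>a \<star> d\<close>, so
    it suffices that \<open>d\<close> lies below \<open>a\<close>.\<close>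
  define d where "d = (a + a) \<star> a"
  have "d \<le> a"
    unfolding d_def by (simp add: star_le_residual zero_least le_add_right)
  then have "a \<star> d \<le> a"
    by (rule star_le_left)
  moreover have "a \<star> d = a + a"
    unfolding d_def by (simp add: star_commute[of "a + a"] star_involution)
  ultimately show "a + a \<le> a"
    by simp
qed (rule le_add_right)

text \<open>By monotonicity \<open>a + b\<close> lies below the double of \<open>sup a b\<close>,
  which idempotence collapses; since 0 is least, \<open>a + b\<close> bounds both summands.\<close>

lemma add_eq_sup: "a + b = sup a b"
proof (rule order.antisym)
  have "a + b \<le> a + sup a b"
    by (simp add: add_mono_right)
  also have "\<dots> \<le> sup a b + sup a b"
    using add_mono_right[of a "sup a b" "sup a b"] by (simp add: add.commute)
  finally show "a + b \<le> sup a b"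
    by (simp add: add_idem)
  show "sup a b \<le> a + b"
    using le_add_right[of b a] by (simp add: le_add_right add.commute)
qed

lemma unity_greatest: "unity u \<Longrightarrow> a \<le> u"
  by (metis unity_def le_add_right)

lemma sup_star_unity: "unity u \<Longrightarrow> sup a (a \<star> u) = u"
  by (simp add: unity_def flip: add_eq_sup)

lemma inf_star_unity:
  assumes "unity u"
  shows "inf a (a \<star> u) = 0"
proof -
  have s: "sup a (a \<star> u) = u"
    by (rule sup_star_unity[OF assms])
  have "inf (a \<star> u) ((a \<star> u) \<star> u) = 0"
    using star_sup_disjoint[of a "a \<star> u"] unfolding s .
  \<comment> \<open>Associativity brings the two copies of \<open>u\<close> together, and
    \<open>u \<star> u = 0\<close>.\<close>
  moreover have "(a \<star> u) \<star> u = a"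
    by (simp add: star_assoc)
  ultimately show ?thesis
    by (simp add: inf_commute)
qed

end

end

theorem theorem3p9:
  fixes u :: "'a::al_monoid"
  assumes "unity u"
    and "\<And>a::'a. isometry (\<lambda>x. a \<star> x)"
  shows "boolean_lattice 0 u"
proof -
  note iso = assms(2)
  \<comment> \<open>The difference is the meet with the complement, so the law tying it to the
    complement holds by reflexivity.\<close>
  have "class.boolean_algebra (\<lambda>x y. inf x (y \<star> u)) (\<lambda>x. x \<star> u) inf (\<le>) (<) sup 0 u"
  proof unfold_locales
    fix x y z :: 'a
    show "0 \<le> x"
      by (rule zero_least[OF iso])
    show "x \<le> u"
      by (rule unity_greatest[OF iso assms(1)])
    show "sup x (inf y z) = inf (sup x y) (sup x z)"
      using add_inf_distrib[of x y z] by (simp add: add_eq_sup[OF iso])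
    show "inf x (x \<star> u) = 0"
      by (rule inf_star_unity[OF iso assms(1)])
    show "sup x (x \<star> u) = u"
      by (rule sup_star_unity[OF iso assms(1)])
  qed simp
  then show ?thesis
    unfolding boolean_lattice_def by (rule exI[where x = "\<lambda>x. x \<star> u"])
qed

end
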